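(* Let $\mathfrak D=\bigcup_n\big\{X\in(M_n)^d_{sa}:\big\|\sum_{j=1}^dX_j\otimes\overline{X_j}\big\|\le1\big\}$. Then $\mathfrak D$ is self-dual, i.e. $\mathfrak D^\bullet=\mathfrak D$.
   Context: $(M_n)^d_{sa}$ is the set of $d$-tuples of self-adjoint $n\times n$ complex matrices, and $\overline{X}=[\overline{x_{ij}}]$ is the entrywise complex conjugate of $X=[x_{ij}]$. For $\mathcal S\subseteq\bigcup_n(M_n)^d_{sa}$, the polar dual is $\mathcal S^\bullet=\bigcup_n\mathcal S^\bullet_n$, $\mathcal S^\bullet_n=\{X\in(M_n)^d_{sa}:\sum_jA_j\otimes X_j\le I\text{ for all }A\in\mathcal S\}$ (with $A$ ranging over all levels of $\mathcal S$). *)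

theory Defs
  imports
    "Jordan_Normal_Form.Schur_Decomposition"
    "HOL-Analysis.L2_Norm"
begin

definition self_adjoint_mat :: "complex mat \<Rightarrow> bool" where
  "self_adjoint_mat A \<longleftrightarrow> mat_adjoint A = A"

definition kronecker :: "complex mat \<Rightarrow> complex mat \<Rightarrow> complex mat" where
  "kronecker A B = mat (dim_row A * dim_row B) (dim_col A * dim_col B)
     (\<lambda>(i, k). A $$ (i div dim_row B, k div dim_col B) * B $$ (i mod dim_row B, k mod dim_col B))"

text \<open>Sums of matrices are taken entrywise, with the dimension given explicitly, since matrices of
  varying dimension have no common zero element.\<close>

definition sum_mats :: "nat \<Rightarrow> nat \<Rightarrow> (nat \<Rightarrow> complex mat) \<Rightarrow> complex mat" where
  "sum_mats N d F = mat N N (\<lambda>p. \<Sum>j<d. F j $$ p)"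

abbreviation conj_mat :: "complex mat \<Rightarrow> complex mat" where
  "conj_mat \<equiv> map_mat cnj"

definition vec_norm :: "complex vec \<Rightarrow> real" where
  "vec_norm v = L2_set (\<lambda>i. cmod (v $ i)) {..<dim_vec v}"

definition op_norm :: "complex mat \<Rightarrow> real" where
  "op_norm A = (SUP v\<in>{v \<in> carrier_vec (dim_col A). vec_norm v \<le> 1}. vec_norm (A *\<^sub>v v))"

definition pos_semidef_mat :: "complex mat \<Rightarrow> bool" where
  "pos_semidef_mat A \<longleftrightarrow>
     self_adjoint_mat A \<and> (\<forall>v \<in> carrier_vec (dim_row A). 0 \<le> (A *\<^sub>v v) \<bullet>c v)"

text \<open>The order on self-adjoint matrices. It differs from \<open>\<le>\<close> on type \<open>mat\<close>, which is entrywise.\<close>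

definition loewner_le :: "complex mat \<Rightarrow> complex mat \<Rightarrow> bool" where
  "loewner_le A B \<longleftrightarrow> pos_semidef_mat (B - A)"

text \<open>The set of \<open>d\<close>-tuples of self-adjoint \<open>n \<times> n\<close> matrices; tuples are lists indexed from 0.\<close>

definition sa_tuples :: "nat \<Rightarrow> nat \<Rightarrow> complex mat list set" where
  "sa_tuples d n =
     {X. length X = d \<and> (\<forall>j<d. X ! j \<in> carrier_mat n n \<and> self_adjoint_mat (X ! j))}"

definition polar_dual_level :: "nat \<Rightarrow> complex mat list set \<Rightarrow> nat \<Rightarrow> complex mat list set" where
  "polar_dual_level d S n =
     {X \<in> sa_tuples d n. \<forall>m\<ge>1. \<forall>A \<in> S \<inter> sa_tuples d m.
        loewner_le (sum_mats (m * n) d (\<lambda>j. kronecker (A ! j) (X ! j))) (1\<^sub>m (m * n))}"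

definition polar_dual :: "nat \<Rightarrow> complex mat list set \<Rightarrow> complex mat list set" where
  "polar_dual d S = (\<Union>n\<in>{1..}. polar_dual_level d S n)"

definition frakD :: "nat \<Rightarrow> complex mat list set" where
  "frakD d = (\<Union>n\<in>{1..}.
     {X \<in> sa_tuples d n.
        op_norm (sum_mats (n * n) d (\<lambda>j. kronecker (X ! j) (conj_mat (X ! j)))) \<le> 1})"

end

theory Submission
  imports Defs
begin

text \<open>Write a vector of \<open>\<complex>\<^sup>m \<otimes> \<complex>\<^sup>n\<close> as an \<open>m \<times> n\<close> matrix \<open>V = \<Sum>\<^sub>k s\<^sub>k u\<^sub>k w\<^sub>k\<^sup>T\<close> in singular value form. Then
  the quadratic form of \<open>\<Sum>\<^sub>t A\<^sub>t \<otimes> X\<^sub>t\<close> at \<open>V\<close> is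
  \<open>\<Sum>\<^sub>t \<Sum>\<^sub>k \<Sum>\<^sub>l s\<^sub>k s\<^sub>l \<langle>A\<^sub>t u\<^sub>l, u\<^sub>k\<rangle> \<langle>X\<^sub>t w\<^sub>l, w\<^sub>k\<rangle>\<close>. By Cauchy--Schwarz it is controlled by
  \<open>\<Sum> s\<^sub>k s\<^sub>l \<bar>\<langle>A\<^sub>t u\<^sub>l, u\<^sub>k\<rangle>\<bar>\<^sup>2\<close>, the form of \<open>\<Sum>\<^sub>t A\<^sub>t \<otimes> cnj A\<^sub>t\<close> at the positive matrix
  \<open>\<Sum>\<^sub>k s\<^sub>k u\<^sub>k u\<^sub>k\<^sup>*\<close>, which has the same Hilbert--Schmidt norm as \<open>V\<close>, and by the analogous sum for \<open>X\<close>.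
  So a common upper bound \<open>K\<close> on the forms of \<open>\<Sum>\<^sub>t A\<^sub>t \<otimes> cnj A\<^sub>t\<close> and \<open>\<Sum>\<^sub>t X\<^sub>t \<otimes> cnj X\<^sub>t\<close> bounds the modulus of
  the form of \<open>\<Sum>\<^sub>t A\<^sub>t \<otimes> X\<^sub>t\<close>.

  With \<open>K = 1\<close> this says that \<open>frakD\<close> is contained in its polar dual. Conversely, let \<open>X\<close> be in the polar
  dual and suppose that \<open>c\<close>, the norm of \<open>\<Sum>\<^sub>t X\<^sub>t \<otimes> cnj X\<^sub>t\<close>, exceeds 1. Then \<open>cnj X / sqrt c\<close> lies in
  \<open>frakD\<close>, so the form of \<open>\<Sum>\<^sub>t cnj X\<^sub>t \<otimes> X\<^sub>t\<close> is at most \<open>sqrt c\<close>. Applied to the pair \<open>X\<close>, \<open>cnj X\<close>, the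
  estimate turns this one-sided bound into a bound on the numerical radius of a Hermitian matrix,
  that is on its norm, so \<open>c \<le> sqrt c\<close>, a contradiction.\<close>

section \<open>Spectral and singular value decompositions\<close>

lemma trace_mult_commute:
  fixes A B :: "'a :: comm_semiring_0 mat"
  assumes "A \<in> carrier_mat n n" "B \<in> carrier_mat n n"
  shows "(\<Sum>i<n. (A * B) $$ (i, i)) = (\<Sum>i<n. (B * A) $$ (i, i))"
proof -
  have "(\<Sum>i<n. (A * B) $$ (i, i)) = (\<Sum>i<n. \<Sum>j<n. A $$ (i, j) * B $$ (j, i))"
    using assms by (intro sum.cong) (auto simp: scalar_prod_def atLeast0LessThan)
  also have "\<dots> = (\<Sum>j<n. \<Sum>i<n. B $$ (j, i) * A $$ (i, j))"
    by (subst sum.swap) (simp add: mult.commute)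
  also have "\<dots> = (\<Sum>i<n. (B * A) $$ (i, i))"
    using assms by (intro sum.cong) (auto simp: scalar_prod_def atLeast0LessThan)
  finally show ?thesis .
qed

text \<open>Schur triangularization makes \<open>A\<close> similar to an upper triangular
  \<open>B\<close> whose diagonal lists the eigenvalues, so \<open>B\<close> is strictly upper
  triangular. Cyclicity of the trace moves the computation from \<open>A * A\<close> to
  \<open>B * B\<close>.\<close>

lemma nilpotent_spectrum_trace_square:
  fixes A :: "complex mat"
  assumes A: "A \<in> carrier_mat n n" and ev: "\<And>k. eigenvalue A k \<Longrightarrow> k = 0"
  shows "(\<Sum>i<n. (A * A) $$ (i, i)) = 0"
proof -
  obtain es where es: "char_poly A = (\<Prod>a\<leftarrow>es. [:- a, 1:])"
    using char_poly_factorized[OF A] by blast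
  obtain B P Q where schur: "schur_decomposition A es = (B, P, Q)"
    by (cases "schur_decomposition A es") auto
  have sim: "similar_mat_wit A B P Q" and ut: "upper_triangular B" and diag: "diag_mat B = es"
    using schur_decomposition[OF A es schur] by auto
  have c: "P \<in> carrier_mat n n" "Q \<in> carrier_mat n n" "B \<in> carrier_mat n n"
    and QP: "Q * P = 1\<^sub>m n" and APBQ: "A = P * B * Q"
    using similar_mat_witD2[OF A sim] by auto
  have zero: "k = 0" if "k \<in> set es" for k
  proof (rule ev)
    show "eigenvalue A k"
      unfolding eigenvalue_root_char_poly[OF A] es poly_prod_list prod_list_zero_iff
      using that by (auto intro!: image_eqI)
  qed
  have low: "B $$ (i, j) = 0" if "j \<le> i" "i < n" for i j
  proof (cases "i = j")
    case True
    have "B $$ (i, i) \<in> set (diag_mat B)"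
      using that c by (auto simp: diag_mat_def)
    then show ?thesis using zero diag True by auto
  next
    case False
    then show ?thesis using ut that c by auto
  qed
  have "(\<Sum>i<n. (A * A) $$ (i, i)) = (\<Sum>i<n. (P * (B * (B * Q))) $$ (i, i))"
  proof -
    have "A * A = (P * B * Q) * (P * B * Q)"
      using APBQ by simp
    also have "\<dots> = P * (B * ((Q * P) * (B * Q)))"
      using c by (simp add: assoc_mult_mat[of _ n n _ n _ n])
    also have "\<dots> = P * (B * (B * Q))"
      using c by (simp add: QP)
    finally show ?thesis by simp
  qed
  also have "\<dots> = (\<Sum>i<n. ((B * (B * Q)) * P) $$ (i, i))"
    using c by (intro trace_mult_commute) auto
  also have "(B * (B * Q)) * P = B * B"
    using c by (simp add: assoc_mult_mat[of _ n n _ n _ n] QP)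
  also have "(\<Sum>i<n. (B * B) $$ (i, i)) = 0"
  proof (rule sum.neutral, safe)
    fix i assume i: "i < n"
    have "(B * B) $$ (i, i) = (\<Sum>j<n. B $$ (i, j) * B $$ (j, i))"
      using i c by (auto simp: scalar_prod_def atLeast0LessThan)
    \<comment> \<open>Of the entries at (i, j) and (j, i), one lies on or below the
      diagonal.\<close>
    also have "\<dots> = 0"
      using low i by (intro sum.neutral) (metis lessThan_iff linear mult_zero_left mult_zero_right)
    finally show "(B * B) $$ (i, i) = 0" .
  qed
  finally show ?thesis .
qed

text \<open>For Hermitian \<open>H\<close> the trace of the square is the sum of all squared moduli
  of entries. If 0 were the only eigenvalue this trace would vanish by the previous lemma,
  contradicting the nonzero entry.\<close>

lemma hermitian_nonzero_eigenvector:
  fixes H :: "nat \<Rightarrow> nat \<Rightarrow> complex"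
  assumes herm: "\<And>i j. i < n \<Longrightarrow> j < n \<Longrightarrow> H j i = cnj (H i j)"
    and nz: "i0 < n" "j0 < n" "H i0 j0 \<noteq> 0"
  obtains z c where "c \<noteq> 0" "(\<Sum>i<n. z i * cnj (z i)) = 1"
    "\<And>i. i < n \<Longrightarrow> (\<Sum>j<n. H i j * z j) = c * z i"
proof -
  define A where "A = mat n n (\<lambda>(i, j). H i j)"
  have A: "A \<in> carrier_mat n n" by (simp add: A_def)
  have "\<exists>c. eigenvalue A c \<and> c \<noteq> 0"
  proof (rule ccontr)
    assume "\<not> ?thesis"
    then have "(\<Sum>i<n. (A * A) $$ (i, i)) = 0"
      using nilpotent_spectrum_trace_square[OF A] by blast
    also have "(\<Sum>i<n. (A * A) $$ (i, i)) = (\<Sum>i<n. \<Sum>j<n. H i j * H j i)"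
      by (intro sum.cong) (auto simp: scalar_prod_def atLeast0LessThan A_def)
    also have "\<dots> = (\<Sum>i<n. \<Sum>j<n. of_real ((cmod (H i j))\<^sup>2))"
      using herm by (intro sum.cong refl) (metis complex_norm_square lessThan_iff)
    also have "\<dots> = of_real (\<Sum>i<n. \<Sum>j<n. (cmod (H i j))\<^sup>2)" by simp
    finally have "(\<Sum>i<n. \<Sum>j<n. (cmod (H i j))\<^sup>2) = 0"
      using of_real_eq_0_iff by blast
    then have "(\<Sum>j<n. (cmod (H i0 j))\<^sup>2) = 0"
      using nz by (subst (asm) sum_nonneg_eq_0_iff) (auto intro: sum_nonneg)
    then have "(cmod (H i0 j0))\<^sup>2 = 0"
      using nz by (subst (asm) sum_nonneg_eq_0_iff) auto
    then show False using nz by simp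
  qed
  then obtain c v where c: "c \<noteq> 0" and v: "v \<in> carrier_vec n" "v \<noteq> 0\<^sub>v n" "A *\<^sub>v v = c \<cdot>\<^sub>v v"
    unfolding eigenvalue_def eigenvector_def using A by auto
  obtain k where k: "k < n" "v $ k \<noteq> 0"
    using v by (metis carrier_vecD eq_vecI index_zero_vec(1) index_zero_vec(2))
  define q where "q = (\<Sum>i<n. (cmod (v $ i))\<^sup>2)"
  have "0 < q" unfolding q_def using k by (intro sum_pos2[of _ k]) auto
  have eig: "(\<Sum>j<n. H i j * v $ j) = c * v $ i" if "i < n" for i
  proof -
    have "(A *\<^sub>v v) $ i = (\<Sum>j<n. H i j * v $ j)"
      using that v(1) by (simp add: A_def scalar_prod_def atLeast0LessThan)
    then show ?thesis using v that by simp
  qed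
  define z where "z = (\<lambda>i. v $ i / of_real (sqrt q))"
  have "(\<Sum>i<n. z i * cnj (z i)) = (\<Sum>i<n. of_real ((cmod (v $ i))\<^sup>2 / q))"
    using \<open>0 < q\<close> unfolding z_def
    by (intro sum.cong refl)
      (simp add: complex_norm_square del: of_real_power, simp flip: of_real_mult)
  also have "\<dots> = of_real ((\<Sum>i<n. (cmod (v $ i))\<^sup>2) / q)"
    by (simp add: sum_divide_distrib)
  finally have "(\<Sum>i<n. z i * cnj (z i)) = 1" using \<open>0 < q\<close> by (simp add: q_def)
  moreover have "(\<Sum>j<n. H i j * z j) = c * z i" if "i < n" for i
    using eig[OF that] by (simp add: z_def flip: sum_divide_distrib)
  ultimately show thesis using that c by blast
qed

lemma sum_rotate:
  "(\<Sum>a\<in>A. \<Sum>b\<in>B. \<Sum>c\<in>C. f a b c) = (\<Sum>b\<in>B. \<Sum>c\<in>C. \<Sum>a\<in>A. f a b c)"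
proof -
  have "(\<Sum>a\<in>A. \<Sum>b\<in>B. \<Sum>c\<in>C. f a b c) = (\<Sum>b\<in>B. \<Sum>a\<in>A. \<Sum>c\<in>C. f a b c)"
    by (rule sum.swap)
  also have "\<dots> = (\<Sum>b\<in>B. \<Sum>c\<in>C. \<Sum>a\<in>A. f a b c)"
    by (intro sum.cong refl sum.swap)
  finally show ?thesis .
qed

section \<open>Inner products and matrix action on coordinate functions\<close>

definition cinner :: "nat \<Rightarrow> (nat \<Rightarrow> complex) \<Rightarrow> (nat \<Rightarrow> complex) \<Rightarrow> complex" where
  "cinner n x y = (\<Sum>i<n. x i * cnj (y i))"

definition orthonormal_family :: "nat \<Rightarrow> nat \<Rightarrow> (nat \<Rightarrow> nat \<Rightarrow> complex) \<Rightarrow> bool" where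
  "orthonormal_family n r w \<longleftrightarrow>
     (\<forall>k<r. \<forall>l<r. cinner n (w k) (w l) = (if k = l then 1 else 0))"

text \<open>Vectors and matrices are plain functions of which only finitely many values matter. The
  row index is unrestricted, so rectangular matrices are covered as well.\<close>

definition mat_app :: "nat \<Rightarrow> (nat \<Rightarrow> nat \<Rightarrow> complex) \<Rightarrow> (nat \<Rightarrow> complex) \<Rightarrow> nat \<Rightarrow> complex" where
  "mat_app n H x i = (\<Sum>j<n. H i j * x j)"

lemma cinner_commute: "cinner n y x = cnj (cinner n x y)"
  by (simp add: cinner_def mult.commute)

lemma cinner_self: "cinner n x x = of_real (\<Sum>i<n. (cmod (x i))\<^sup>2)"
  unfolding cinner_def of_real_sum by (intro sum.cong refl) (metis complex_norm_square)

lemma cinner_self_eq_0_iff: "cinner n x x = 0 \<longleftrightarrow> (\<forall>i<n. x i = 0)"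
  unfolding cinner_self of_real_eq_0_iff by (subst sum_nonneg_eq_0_iff) auto

lemma cinner_cong:
  "(\<And>i. i < n \<Longrightarrow> x i = x' i) \<Longrightarrow> (\<And>i. i < n \<Longrightarrow> y i = y' i) \<Longrightarrow> cinner n x y = cinner n x' y'"
  by (simp add: cinner_def)

lemma cinner_scale_left: "cinner n (\<lambda>i. c * x i) y = c * cinner n x y"
  by (simp add: cinner_def sum_distrib_left mult.assoc)

lemma cinner_scale_right: "cinner n x (\<lambda>i. c * y i) = cnj c * cinner n x y"
  by (simp add: cinner_def sum_distrib_left mult_ac)

lemma cinner_mat_app_hermitian:
  assumes "\<And>i j. i < n \<Longrightarrow> j < n \<Longrightarrow> H j i = cnj (H i j)"
  shows "cinner n (mat_app n H x) y = cinner n x (mat_app n H y)"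
proof -
  have "cinner n (mat_app n H x) y = (\<Sum>i<n. \<Sum>j<n. H i j * x j * cnj (y i))"
    by (simp add: cinner_def mat_app_def sum_distrib_right)
  also have "\<dots> = (\<Sum>j<n. \<Sum>i<n. x j * cnj (H j i * y i))"
  proof (subst sum.swap, intro sum.cong refl)
    fix i j assume "i \<in> {..<n}" "j \<in> {..<n}"
    then have "H i j = cnj (H j i)" by (intro assms) auto
    then show "H i j * x j * cnj (y i) = x j * cnj (H j i * y i)" by simp
  qed
  also have "\<dots> = cinner n x (mat_app n H y)"
    by (simp add: cinner_def mat_app_def sum_distrib_left)
  finally show ?thesis .
qed

text \<open>The matrix on the right is the Gram matrix V* V; this lets its spectral decomposition
  govern \<open>V\<close>.\<close>

lemma cinner_mat_app_mat_app:
  "cinner m (mat_app n V x) (mat_app n V y) =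
   cinner n (mat_app n (\<lambda>i j. \<Sum>p<m. cnj (V p i) * V p j) x) y"
proof -
  have "cinner m (mat_app n V x) (mat_app n V y) =
      (\<Sum>p<m. \<Sum>i<n. \<Sum>j<n. cnj (V p i) * V p j * x j * cnj (y i))"
    by (simp add: cinner_def mat_app_def sum_distrib_left sum_distrib_right mult_ac)
  also have "\<dots> = (\<Sum>i<n. \<Sum>j<n. \<Sum>p<m. cnj (V p i) * V p j * x j * cnj (y i))"
    by (rule sum_rotate)
  also have "\<dots> = cinner n (mat_app n (\<lambda>i j. \<Sum>p<m. cnj (V p i) * V p j) x) y"
    by (simp add: cinner_def mat_app_def sum_distrib_right)
  finally show ?thesis .
qed

text \<open>Used to split off eigenpairs already found: the deflated matrix agrees with
  \<open>H\<close> on vectors orthogonal to all \<open>w k\<close>, and annihilates each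
  \<open>w k\<close> if these are orthonormal eigenvectors with eigenvalues
  \<open>c k\<close>.\<close>

lemma mat_app_deflate:
  "mat_app n (\<lambda>i j. H i j - (\<Sum>k<r. c k * w k i * cnj (w k j))) x i =
   mat_app n H x i - (\<Sum>k<r. c k * cinner n x (w k) * w k i)"
proof -
  have "(\<Sum>j<n. (\<Sum>k<r. c k * w k i * cnj (w k j)) * x j) =
      (\<Sum>k<r. \<Sum>j<n. c k * (x j * cnj (w k j)) * w k i)"
    by (subst sum.swap) (simp add: sum_distrib_left sum_distrib_right mult_ac)
  also have "\<dots> = (\<Sum>k<r. c k * cinner n x (w k) * w k i)"
    by (simp add: cinner_def sum_distrib_left sum_distrib_right)
  finally show ?thesis
    by (simp add: mat_app_def left_diff_distrib sum_subtractf)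
qed

text \<open>The projection matrix \<open>P = \<Sum>\<^sub>k w\<^sub>k w\<^sub>k\<^sup>*\<close> satisfies \<open>P\<^sub>i\<^sub>i = \<Sum>\<^sub>j \<bar>P\<^sub>i\<^sub>j\<bar>\<^sup>2\<close>, so its diagonal entries are at most 1,
  while its trace is \<open>r\<close>.\<close>

lemma orthonormal_family_le_dim:
  assumes on: "orthonormal_family n r w"
  shows "r \<le> n"
proof -
  define q where "q i = (\<Sum>k<r. (cmod (w k i))\<^sup>2)" for i
  define p where "p i j = (\<Sum>k<r. w k i * cnj (w k j))" for i j
  have pq: "p i i = of_real (q i)" for i
    unfolding p_def q_def of_real_sum by (intro sum.cong refl) (metis complex_norm_square)
  have q1: "q i \<le> 1" if i: "i < n" for i
  proof -
    have "(\<Sum>j<n. p i j * cnj (p i j)) =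
        (\<Sum>j<n. \<Sum>k<r. \<Sum>l<r. w k i * cnj (w l i) * (w l j * cnj (w k j)))"
      by (simp add: p_def sum_distrib_left sum_distrib_right mult_ac)
    also have "\<dots> = (\<Sum>k<r. \<Sum>l<r. \<Sum>j<n. w k i * cnj (w l i) * (w l j * cnj (w k j)))"
      by (rule sum_rotate)
    also have "\<dots> = (\<Sum>k<r. \<Sum>l<r. w k i * cnj (w l i) * cinner n (w l) (w k))"
      by (simp add: cinner_def sum_distrib_left)
    also have "\<dots> = (\<Sum>k<r. \<Sum>l<r. if l = k then w k i * cnj (w l i) else 0)"
      using on by (intro sum.cong refl) (auto simp: orthonormal_family_def)
    also have "\<dots> = p i i" by (simp add: p_def)
    finally have "of_real (\<Sum>j<n. (cmod (p i j))\<^sup>2) = (of_real (q i) :: complex)"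
      by (simp only: pq cinner_def[symmetric] cinner_self)
    then have "(\<Sum>j<n. (cmod (p i j))\<^sup>2) = q i" by (simp only: of_real_eq_iff)
    moreover have "(cmod (p i i))\<^sup>2 \<le> (\<Sum>j<n. (cmod (p i j))\<^sup>2)"
      using i by (intro member_le_sum) auto
    ultimately have "(q i)\<^sup>2 \<le> q i" by (simp add: pq)
    show ?thesis
    proof (rule ccontr)
      assume "\<not> q i \<le> 1"
      then have "q i * 1 < q i * q i" by (intro mult_strict_left_mono) auto
      then show False using \<open>(q i)\<^sup>2 \<le> q i\<close> by (simp add: power2_eq_square)
    qed
  qed
  have "of_real (\<Sum>i<n. q i) = (\<Sum>k<r. cinner n (w k) (w k))"
    unfolding cinner_self q_def by (subst sum.swap) simp
  also have "\<dots> = (\<Sum>k<r. 1)"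
    using on by (intro sum.cong) (auto simp: orthonormal_family_def)
  also have "\<dots> = of_real (real r)" by simp
  finally have "(\<Sum>i<n. q i) = real r" by (simp only: of_real_eq_iff)
  moreover have "(\<Sum>i<n. q i) \<le> (\<Sum>i<n. 1)"
    using q1 by (intro sum_mono) auto
  ultimately show ?thesis by simp
qed

text \<open>Take an orthonormal family of eigenvectors with nonzero eigenvalues of maximal size and
  deflate. A nonzero remainder \<open>D\<close> would have an eigenvector with nonzero eigenvalue,
  which extends the family.\<close>

lemma hermitian_spectral_decomposition:
  fixes H :: "nat \<Rightarrow> nat \<Rightarrow> complex"
  assumes herm: "\<And>i j. i < n \<Longrightarrow> j < n \<Longrightarrow> H j i = cnj (H i j)"
  obtains r w c where "orthonormal_family n r w"
    "\<And>k. k < r \<Longrightarrow> c k \<noteq> 0"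
    "\<And>k i. k < r \<Longrightarrow> i < n \<Longrightarrow> mat_app n H (w k) i = c k * w k i"
    "\<And>i j. i < n \<Longrightarrow> j < n \<Longrightarrow> H i j = (\<Sum>k<r. c k * w k i * cnj (w k j))"
proof -
  define eig where "eig r w c \<longleftrightarrow> orthonormal_family n r w \<and>
    (\<forall>k<r. c k \<noteq> 0 \<and> (\<forall>i<n. mat_app n H (w k) i = c k * w k i))" for r w and c :: "nat \<Rightarrow> complex"
  have "\<exists>w c. eig 0 w c" by (simp add: eig_def orthonormal_family_def)
  moreover have "\<forall>r. (\<exists>w c. eig r w c) \<longrightarrow> r < Suc n"
    using orthonormal_family_le_dim by (auto simp: eig_def less_Suc_eq_le)
  \<comment> \<open>A maximal size exists because orthonormal families have at most \<open>n\<close>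
    members and the empty family qualifies.\<close>
  ultimately obtain r where "\<exists>w c. eig r w c"
    and r_max: "\<And>r'. (\<exists>w c. eig r' w c) \<Longrightarrow> r' \<le> r"
    using ex_has_greatest_nat[of "\<lambda>r. \<exists>w c. eig r w c" 0 "\<lambda>r. r" "Suc n"] by blast
  then obtain w c where "eig r w c" by blast
  then have on: "orthonormal_family n r w" and c0: "\<And>k. k < r \<Longrightarrow> c k \<noteq> 0"
    and ev: "\<And>k i. k < r \<Longrightarrow> i < n \<Longrightarrow> mat_app n H (w k) i = c k * w k i"
    by (auto simp: eig_def)
  have onD: "cinner n (w k) (w l) = (if k = l then 1 else 0)" if "k < r" "l < r" for k l
    using on that by (simp add: orthonormal_family_def)
  \<comment> \<open>Reality of the eigenvalues keeps the deflated matrix Hermitian.\<close>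
  have c_real: "cnj (c k) = c k" if k: "k < r" for k
  proof -
    have "c k = cinner n (\<lambda>i. c k * w k i) (w k)"
      using onD k by (simp add: cinner_scale_left)
    also have "\<dots> = cinner n (mat_app n H (w k)) (w k)"
      using ev k by (intro cinner_cong) auto
    also have "\<dots> = cinner n (w k) (mat_app n H (w k))"
      using herm by (rule cinner_mat_app_hermitian)
    also have "\<dots> = cinner n (w k) (\<lambda>i. c k * w k i)"
      using ev k by (intro cinner_cong) auto
    also have "\<dots> = cnj (c k)"
      using onD k by (simp add: cinner_scale_right)
    finally show ?thesis by simp
  qed
  define D where "D = (\<lambda>i j. H i j - (\<Sum>k<r. c k * w k i * cnj (w k j)))"
  have D_herm: "D j i = cnj (D i j)" if "i < n" "j < n" for i j
    using herm[OF that] c_real by (simp add: D_def mult_ac)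
  have D_w: "mat_app n D (w k) i = 0" if k: "k < r" and i: "i < n" for k i
  proof -
    have "(\<Sum>l<r. c l * cinner n (w k) (w l) * w l i) = (\<Sum>l<r. if l = k then c l * w l i else 0)"
      using k onD by (intro sum.cong) auto
    then show ?thesis
      unfolding D_def mat_app_deflate using ev k i by simp
  qed
  have "D i j = 0" if ij: "i < n" "j < n" for i j
  proof (rule ccontr)
    assume "D i j \<noteq> 0"
    then obtain z e where e: "e \<noteq> 0" and z1: "(\<Sum>i<n. z i * cnj (z i)) = 1"
      and Dz: "\<And>i. i < n \<Longrightarrow> (\<Sum>j<n. D i j * z j) = e * z i"
      using hermitian_nonzero_eigenvector[of n D, OF D_herm ij] by blast
    \<comment> \<open>Eigenvectors of the Hermitian \<open>D\<close> for the distinct eigenvalues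
      \<open>e\<close> and 0 are orthogonal, so \<open>D\<close> and \<open>H\<close> agree on
      \<open>z\<close>.\<close>
    have zw: "cinner n z (w k) = 0" if k: "k < r" for k
    proof -
      have "e * cinner n z (w k) = cinner n (mat_app n D z) (w k)"
        unfolding cinner_scale_left[symmetric] using Dz by (intro cinner_cong) (auto simp: mat_app_def)
      also have "\<dots> = cinner n z (mat_app n D (w k))"
        using D_herm by (rule cinner_mat_app_hermitian)
      also have "\<dots> = 0"
        using D_w[OF k] by (simp add: cinner_def)
      finally show ?thesis using e by simp
    qed
    have "mat_app n H z i = e * z i" if "i < n" for i
      using Dz[OF that] mat_app_deflate[where H = H and x = z and w = w and c = c and r = r and i = i and n = n] zw by (simp add: D_def mat_app_def)
    moreover have "orthonormal_family n (Suc r) (w(r := z))"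
    proof -
      have "cinner n (w k) z = 0" if "k < r" for k
        using zw[OF that] cinner_commute[of n "w k" z] by simp
      moreover have "cinner n z z = 1" using z1 by (simp add: cinner_def)
      ultimately show ?thesis
        using onD zw by (auto simp: orthonormal_family_def less_Suc_eq)
    qed
    ultimately have "eig (Suc r) (w(r := z)) (c(r := e))"
      using ev c0 e by (auto simp: eig_def less_Suc_eq)
    then show False using r_max[of "Suc r"] by auto
  qed
  then show thesis
    using that[OF on c0 ev] by (simp add: D_def)
qed

text \<open>The eigenvectors \<open>w k\<close> of V* V with nonzero eigenvalues have pairwise
  orthogonal images under \<open>V\<close>, and normalizing these gives \<open>u k\<close>. Since
  the expansion uses \<open>w k j\<close> unconjugated, the right family handed out at the end is
  the conjugate of the eigenvectors.\<close>

lemma singular_value_decomposition: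
  fixes V :: "nat \<Rightarrow> nat \<Rightarrow> complex"
  obtains r s u w where "\<And>k. k < r \<Longrightarrow> 0 \<le> s k"
    "orthonormal_family m r u" "orthonormal_family n r w"
    "\<And>p j. p < m \<Longrightarrow> j < n \<Longrightarrow> V p j = (\<Sum>k<r. of_real (s k) * u k p * w k j)"
proof -
  define H where "H = (\<lambda>i j. \<Sum>p<m. cnj (V p i) * V p j)"
  have H_herm: "H j i = cnj (H i j)" for i j by (simp add: H_def mult.commute)
  obtain r w c where on: "orthonormal_family n r w"
    and c0: "\<And>k. k < r \<Longrightarrow> c k \<noteq> 0"
    and ev: "\<And>k i. k < r \<Longrightarrow> i < n \<Longrightarrow> mat_app n H (w k) i = c k * w k i"
    and H_eq: "\<And>i j. i < n \<Longrightarrow> j < n \<Longrightarrow> H i j = (\<Sum>k<r. c k * w k i * cnj (w k j))"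
    by (rule hermitian_spectral_decomposition[of n H, OF H_herm]) blast
  have ip: "cinner m (mat_app n V (w k)) (mat_app n V (w l)) = (if k = l then c k else 0)"
    if "k < r" "l < r" for k l
  proof -
    have "cinner m (mat_app n V (w k)) (mat_app n V (w l)) = cinner n (\<lambda>i. c k * w k i) (w l)"
      unfolding cinner_mat_app_mat_app H_def[symmetric] using ev that by (intro cinner_cong) auto
    then show ?thesis using on that by (simp add: cinner_scale_left orthonormal_family_def)
  qed
  \<comment> \<open>The eigenvalue of V* V at \<open>w k\<close> is the squared length of V applied
    to \<open>w k\<close>, so the singular value is its square root.\<close>
  define q where "q k = (\<Sum>i<m. (cmod (mat_app n V (w k) i))\<^sup>2)" for k
  have cq: "c k = of_real (q k)" if "k < r" for k
    using ip[of k k] that by (simp add: cinner_self q_def)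
  have q_pos: "0 < q k" if "k < r" for k
  proof -
    have "0 \<le> q k" unfolding q_def by (simp add: sum_nonneg)
    moreover have "q k \<noteq> 0" using cq c0 that by fastforce
    ultimately show ?thesis by simp
  qed
  define u where "u = (\<lambda>k p. of_real (1 / sqrt (q k)) * mat_app n V (w k) p)"
  have "orthonormal_family m r u"
    unfolding orthonormal_family_def
  proof (intro allI impI)
    fix k l assume kl: "k < r" "l < r"
    have "cinner m (u k) (u l) = of_real (1 / sqrt (q k) * (1 / sqrt (q l))) * (if k = l then c k else 0)"
      unfolding u_def cinner_scale_left cinner_scale_right ip[OF kl] by simp
    also have "\<dots> = (if k = l then 1 else 0)"
    proof (cases "k = l")
      case True
      have "1 / sqrt (q k) * (1 / sqrt (q k)) * q k = 1"
        using q_pos[OF kl(1)] by simp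
      then have "complex_of_real (1 / sqrt (q k) * (1 / sqrt (q k))) * of_real (q k) = 1"
        by (metis of_real_1 of_real_mult)
      then show ?thesis using True cq[OF kl(1)] by simp
    qed simp
    finally show "cinner m (u k) (u l) = (if k = l then 1 else 0)" .
  qed
  moreover have "orthonormal_family n r (\<lambda>k j. cnj (w k j))"
    unfolding orthonormal_family_def
  proof (intro allI impI)
    fix k l assume "k < r" "l < r"
    moreover have "cinner n (\<lambda>j. cnj (w k j)) (\<lambda>j. cnj (w l j)) = cinner n (w l) (w k)"
      by (simp add: cinner_def mult.commute)
    ultimately show "cinner n (\<lambda>j. cnj (w k j)) (\<lambda>j. cnj (w l j)) = (if k = l then 1 else 0)"
      using on by (simp add: orthonormal_family_def)
  qed
  moreover have "V p j = (\<Sum>k<r. of_real (sqrt (q k)) * u k p * cnj (w k j))" if pj: "p < m" "j < n" for p j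
  proof -
    \<comment> \<open>\<open>x\<close> is the basis vector with index \<open>j\<close> minus its
      projection onto the span of the eigenvectors. It lies in the kernel of V* V, hence of
      \<open>V\<close>, which expresses column \<open>j\<close> of \<open>V\<close> through the
      images of the \<open>w k\<close>.\<close>
    define x where "x = (\<lambda>i. (if i = j then 1 else 0) - (\<Sum>k<r. w k i * cnj (w k j)))"
    have app_x: "mat_app n M x i = M i j - (\<Sum>k<r. mat_app n M (w k) i * cnj (w k j))"
      for M :: "nat \<Rightarrow> nat \<Rightarrow> complex" and i
    proof -
      have "(\<Sum>l<n. M i l * (\<Sum>k<r. w k l * cnj (w k j))) = (\<Sum>k<r. \<Sum>l<n. M i l * w k l * cnj (w k j))"
        by (subst sum.swap) (simp add: sum_distrib_left mult.assoc)
      moreover have "(\<Sum>l<n. M i l * (if l = j then 1 else 0)) = M i j"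
        using pj by (subst if_distrib) (simp add: cong: if_cong)
      ultimately show ?thesis
        by (simp add: mat_app_def x_def right_diff_distrib sum_subtractf sum_distrib_right)
    qed
    have "mat_app n H x i = 0" if "i < n" for i
      using H_eq[OF that pj(2)] ev that by (simp add: app_x)
    then have "cinner m (mat_app n V x) (mat_app n V x) = 0"
      unfolding cinner_mat_app_mat_app H_def[symmetric] by (simp add: cinner_def)
    then have "mat_app n V x p = 0"
      using pj by (simp add: cinner_self_eq_0_iff)
    then have "V p j = (\<Sum>k<r. mat_app n V (w k) p * cnj (w k j))"
      by (simp add: app_x)
    also have "\<dots> = (\<Sum>k<r. of_real (sqrt (q k)) * u k p * cnj (w k j))"
      using q_pos unfolding u_def by (intro sum.cong refl) (auto simp: less_le)
    finally show ?thesis .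
  qed
  ultimately show thesis
    using that[of r "\<lambda>k. sqrt (q k)"] q_pos by (auto simp: less_imp_le)
qed

section \<open>Quadratic forms of sums of tensor products\<close>

text \<open>This is the quadratic form of the sum of the A_t tensor X_t at \<open>V\<close>,
  regarded as a vector of the tensor product; equivalently the sum of the traces of A_t V X_t^T V*.
  Pairs of indices avoid the \<open>div\<close> and \<open>mod\<close> of
  \<open>kronecker\<close>.\<close>

definition tensor_form ::
    "nat \<Rightarrow> nat \<Rightarrow> nat \<Rightarrow> (nat \<Rightarrow> nat \<Rightarrow> nat \<Rightarrow> complex) \<Rightarrow> (nat \<Rightarrow> nat \<Rightarrow> nat \<Rightarrow> complex) \<Rightarrow>
     (nat \<Rightarrow> nat \<Rightarrow> complex) \<Rightarrow> complex" where
  "tensor_form d m n A X V =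
     (\<Sum>i<m. \<Sum>j<n. (\<Sum>i'<m. \<Sum>j'<n. (\<Sum>t<d. A t i i' * X t j j') * V i' j') * cnj (V i j))"

lemma sum_product_tensor:
  fixes f g :: "nat \<Rightarrow> complex"
  shows "(\<Sum>i<m. \<Sum>j<n. f i * g j * (\<Sum>k<r. a k * u k i * w k j)) =
    (\<Sum>k<r. a k * (\<Sum>i<m. f i * u k i) * (\<Sum>j<n. g j * w k j))"
proof -
  have "(\<Sum>k<r. a k * (\<Sum>i<m. f i * u k i) * (\<Sum>j<n. g j * w k j)) =
      (\<Sum>k<r. \<Sum>i<m. \<Sum>j<n. f i * g j * (a k * u k i * w k j))"
    by (simp add: sum_product sum_distrib_left mult_ac)
  also have "\<dots> = (\<Sum>i<m. \<Sum>j<n. \<Sum>k<r. f i * g j * (a k * u k i * w k j))"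
    by (rule sum_rotate)
  finally show ?thesis by (simp add: sum_distrib_left)
qed

text \<open>Common source of two expansions: \<open>f\<close>, \<open>g\<close> are the images of
  the singular vectors for the quadratic form, and the singular vectors themselves for the
  Hilbert-Schmidt norm.\<close>

lemma sum_tensor_cnj_tensor:
  "(\<Sum>i<m. \<Sum>j<n. (\<Sum>l<r. a l * f l i * g l j) * cnj (\<Sum>k<r. b k * u k i * w k j)) =
   (\<Sum>k<r. \<Sum>l<r. a l * cnj (b k) * cinner m (f l) (u k) * cinner n (g l) (w k))"
proof -
  have "(\<Sum>i<m. \<Sum>j<n. (\<Sum>l<r. a l * f l i * g l j) * cnj (\<Sum>k<r. b k * u k i * w k j)) =
      (\<Sum>i<m. \<Sum>j<n. \<Sum>k<r. cnj (b k) * (cnj (u k i) * cnj (w k j) * (\<Sum>l<r. a l * f l i * g l j)))"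
  proof (intro sum.cong refl)
    fix i j
    have "(\<Sum>l<r. a l * f l i * g l j) * cnj (\<Sum>k<r. b k * u k i * w k j) =
        cnj (\<Sum>k<r. b k * u k i * w k j) * (\<Sum>l<r. a l * f l i * g l j)"
      by (rule mult.commute)
    also have "\<dots> = (\<Sum>k<r. cnj (b k) * (cnj (u k i) * cnj (w k j) * (\<Sum>l<r. a l * f l i * g l j)))"
      unfolding cnj_sum sum_distrib_right by (intro sum.cong refl) (simp add: mult.assoc)
    finally show "(\<Sum>l<r. a l * f l i * g l j) * cnj (\<Sum>k<r. b k * u k i * w k j) = \<dots>" .
  qed
  also have "\<dots> = (\<Sum>k<r. \<Sum>i<m. \<Sum>j<n. cnj (b k) * (cnj (u k i) * cnj (w k j) * (\<Sum>l<r. a l * f l i * g l j)))"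
    by (rule sum_rotate[symmetric])
  also have "\<dots> = (\<Sum>k<r. cnj (b k) * (\<Sum>i<m. \<Sum>j<n. cnj (u k i) * cnj (w k j) * (\<Sum>l<r. a l * f l i * g l j)))"
    by (simp only: sum_distrib_left)
  also have "\<dots> = (\<Sum>k<r. \<Sum>l<r. a l * cnj (b k) * cinner m (f l) (u k) * cinner n (g l) (w k))"
  proof (intro sum.cong refl)
    fix k
    have c: "(\<Sum>i<N. cnj (y i) * x i) = cinner N x y" for N x y
      by (simp add: cinner_def mult.commute)
    have "(\<Sum>i<m. \<Sum>j<n. cnj (u k i) * cnj (w k j) * (\<Sum>l<r. a l * f l i * g l j)) =
        (\<Sum>l<r. a l * cinner m (f l) (u k) * cinner n (g l) (w k))"
      by (simp only: sum_product_tensor c)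
    then show "cnj (b k) * (\<Sum>i<m. \<Sum>j<n. cnj (u k i) * cnj (w k j) * (\<Sum>l<r. a l * f l i * g l j)) =
        (\<Sum>l<r. a l * cnj (b k) * cinner m (f l) (u k) * cinner n (g l) (w k))"
      by (simp only: sum_distrib_left mult_ac)
  qed
  finally show ?thesis .
qed

lemma tensor_form_sum:
  "tensor_form d m n A X V =
     (\<Sum>t<d. \<Sum>i<m. \<Sum>j<n. (\<Sum>i'<m. \<Sum>j'<n. A t i i' * X t j j' * V i' j') * cnj (V i j))"
proof -
  have "tensor_form d m n A X V =
      (\<Sum>i<m. \<Sum>j<n. (\<Sum>i'<m. \<Sum>j'<n. \<Sum>t<d. A t i i' * X t j j' * V i' j') * cnj (V i j))"
    by (simp only: tensor_form_def sum_distrib_right)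
  also have "\<dots> = (\<Sum>i<m. \<Sum>j<n. \<Sum>t<d. (\<Sum>i'<m. \<Sum>j'<n. A t i i' * X t j j' * V i' j') * cnj (V i j))"
    by (simp only: sum_rotate[symmetric] sum_distrib_right[symmetric])
  also have "\<dots> = (\<Sum>t<d. \<Sum>i<m. \<Sum>j<n. (\<Sum>i'<m. \<Sum>j'<n. A t i i' * X t j j' * V i' j') * cnj (V i j))"
    by (rule sum_rotate[symmetric])
  finally show ?thesis .
qed

lemma tensor_form_cong:
  assumes "\<And>t i i'. t < d \<Longrightarrow> i < m \<Longrightarrow> i' < m \<Longrightarrow> A t i i' = B t i i'"
    and "\<And>t j j'. t < d \<Longrightarrow> j < n \<Longrightarrow> j' < n \<Longrightarrow> X t j j' = Y t j j'"
    and "\<And>i j. i < m \<Longrightarrow> j < n \<Longrightarrow> V i j = W i j"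
  shows "tensor_form d m n A X V = tensor_form d m n B Y W"
  unfolding tensor_form_def using assms by (simp cong: sum.cong_simp)

lemma tensor_form_scale_left:
  "tensor_form d m n (\<lambda>t i j. a * A t i j) X V = a * tensor_form d m n A X V"
  by (simp add: tensor_form_def mult.assoc flip: sum_distrib_left)

lemma tensor_form_expansion:
  assumes V: "\<And>i j. i < m \<Longrightarrow> j < n \<Longrightarrow> V i j = (\<Sum>k<r. of_real (s k) * u k i * w k j)"
  shows "tensor_form d m n A X V =
    (\<Sum>t<d. \<Sum>k<r. \<Sum>l<r. of_real (s k * s l) *
       cinner m (mat_app m (A t) (u l)) (u k) * cinner n (mat_app n (X t) (w l)) (w k))"
proof -
  define W where "W i j = (\<Sum>k<r. of_real (s k) * u k i * w k j)" for i j
  have "tensor_form d m n A X V = tensor_form d m n A X W"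
    using V by (intro tensor_form_cong) (simp_all add: W_def)
  also have "\<dots> = (\<Sum>t<d. \<Sum>k<r. \<Sum>l<r. of_real (s k * s l) *
       cinner m (mat_app m (A t) (u l)) (u k) * cinner n (mat_app n (X t) (w l)) (w k))"
    unfolding tensor_form_sum W_def sum_product_tensor mat_app_def[symmetric] sum_tensor_cnj_tensor
    by (simp add: mult_ac)
  finally show ?thesis .
qed

lemma tensor_norm_expansion:
  assumes V: "\<And>i j. i < m \<Longrightarrow> j < n \<Longrightarrow> V i j = (\<Sum>k<r. of_real (s k) * u k i * w k j)"
    and "orthonormal_family m r u" "orthonormal_family n r w"
  shows "(\<Sum>i<m. \<Sum>j<n. (cmod (V i j))\<^sup>2) = (\<Sum>k<r. (s k)\<^sup>2)"
proof -
  have "complex_of_real (\<Sum>i<m. \<Sum>j<n. (cmod (V i j))\<^sup>2) = (\<Sum>i<m. \<Sum>j<n. V i j * cnj (V i j))"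
    unfolding of_real_sum by (intro sum.cong refl complex_norm_square)
  also have "\<dots> = (\<Sum>i<m. \<Sum>j<n. (\<Sum>k<r. of_real (s k) * u k i * w k j) *
      cnj (\<Sum>k<r. of_real (s k) * u k i * w k j))"
    by (intro sum.cong refl) (simp add: V)
  also have "\<dots> = (\<Sum>k<r. \<Sum>l<r. if l = k then of_real ((s k)\<^sup>2) else 0)"
    unfolding sum_tensor_cnj_tensor using assms(2,3)
    by (intro sum.cong refl) (auto simp: orthonormal_family_def power2_eq_square)
  also have "\<dots> = of_real (\<Sum>k<r. (s k)\<^sup>2)" by simp
  finally show ?thesis by (simp only: of_real_eq_iff)
qed

text \<open>The left-hand side is the form of \<open>\<Sum>\<^sub>t A\<^sub>t \<otimes> cnj A\<^sub>t\<close> at the positive matrix \<open>\<Sum>\<^sub>k s\<^sub>k u\<^sub>k u\<^sub>k\<^sup>*\<close>.\<close>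

lemma sum_compressions_le:
  assumes A: "\<And>P. Re (tensor_form d m m A (\<lambda>t i j. cnj (A t i j)) P) \<le> K * (\<Sum>i<m. \<Sum>j<m. (cmod (P i j))\<^sup>2)"
    and u: "orthonormal_family m r u"
  shows "(\<Sum>t<d. \<Sum>k<r. \<Sum>l<r. s k * s l * (cmod (cinner m (mat_app m (A t) (u l)) (u k)))\<^sup>2)
    \<le> K * (\<Sum>k<r. (s k)\<^sup>2)"
proof -
  \<comment> \<open>With conjugated right vectors, \<open>P\<close> becomes the positive matrix with
    eigenvectors \<open>u k\<close> and weights \<open>s k\<close>.\<close>
  define w where "w = (\<lambda>k i. cnj (u k i))"
  define P where "P i j = (\<Sum>k<r. of_real (s k) * u k i * w k j)" for i j
  have cnj_w: "cinner m (\<lambda>i. cnj (x i)) (w k) = cnj (cinner m x (u k))" for x k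
    by (simp add: cinner_def w_def)
  have w: "orthonormal_family m r w"
    using u unfolding orthonormal_family_def by (subst (1) w_def) (auto simp: cnj_w)
  \<comment> \<open>The conjugate of A_t acts on conjugated vectors as the conjugate of A_t, so each
    product of two inner products in the expansion becomes a squared modulus.\<close>
  have app_w: "mat_app m (\<lambda>i j. cnj (A t i j)) (w l) = (\<lambda>i. cnj (mat_app m (A t) (u l) i))" for t l
    by (rule ext) (simp add: mat_app_def w_def)
  have "tensor_form d m m A (\<lambda>t i j. cnj (A t i j)) P =
      (\<Sum>t<d. \<Sum>k<r. \<Sum>l<r. of_real (s k * s l * (cmod (cinner m (mat_app m (A t) (u l)) (u k)))\<^sup>2))"
    by (subst tensor_form_expansion[OF P_def], unfold app_w cnj_w, intro sum.cong refl)
      (simp only: of_real_mult mult.assoc complex_norm_square)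
  then have "Re (tensor_form d m m A (\<lambda>t i j. cnj (A t i j)) P) =
      (\<Sum>t<d. \<Sum>k<r. \<Sum>l<r. s k * s l * (cmod (cinner m (mat_app m (A t) (u l)) (u k)))\<^sup>2)"
    by (simp only: of_real_sum[symmetric] Re_complex_of_real)
  then show ?thesis
    using A[of P] tensor_norm_expansion[OF P_def u w] by simp
qed

text \<open>The hypotheses bound real parts from above only, while the conclusion bounds a modulus.
  This gain is what the second inclusion exploits.\<close>

lemma tensor_form_cauchy_schwarz:
  assumes A: "\<And>P. Re (tensor_form d m m A (\<lambda>t i j. cnj (A t i j)) P) \<le> K * (\<Sum>i<m. \<Sum>j<m. (cmod (P i j))\<^sup>2)"
    and X: "\<And>P. Re (tensor_form d n n X (\<lambda>t i j. cnj (X t i j)) P) \<le> K * (\<Sum>i<n. \<Sum>j<n. (cmod (P i j))\<^sup>2)"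
  shows "cmod (tensor_form d m n A X V) \<le> K * (\<Sum>i<m. \<Sum>j<n. (cmod (V i j))\<^sup>2)"
proof -
  obtain r s u w where s: "\<And>k. k < r \<Longrightarrow> 0 \<le> s k"
    and u: "orthonormal_family m r u" and w: "orthonormal_family n r w"
    and V: "\<And>p j. p < m \<Longrightarrow> j < n \<Longrightarrow> V p j = (\<Sum>k<r. of_real (s k) * u k p * w k j)"
    by (rule singular_value_decomposition[of m n V]) blast
  have expansion: "tensor_form d m n A X V = (\<Sum>t<d. \<Sum>k<r. \<Sum>l<r. of_real (s k * s l) *
      cinner m (mat_app m (A t) (u l)) (u k) * cinner n (mat_app n (X t) (w l)) (w k))"
    using V by (rule tensor_form_expansion)
  have norm: "(\<Sum>i<m. \<Sum>j<n. (cmod (V i j))\<^sup>2) = (\<Sum>k<r. (s k)\<^sup>2)"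
    using V u w by (rule tensor_norm_expansion)
  define a where "a t k l = cmod (cinner m (mat_app m (A t) (u l)) (u k))" for t k l
  define b where "b t k l = cmod (cinner n (mat_app n (X t) (w l)) (w k))" for t k l
  have "cmod (tensor_form d m n A X V) \<le> (\<Sum>t<d. \<Sum>k<r. \<Sum>l<r. \<bar>s k * s l\<bar> * a t k l * b t k l)"
    unfolding expansion a_def b_def
    by (intro sum_norm_le) (simp add: norm_mult abs_mult)
  \<comment> \<open>Cauchy-Schwarz enters as the arithmetic-geometric mean inequality with
    nonnegative weights \<open>s k * s l\<close>; this suffices because both forms have the same
    bound \<open>K\<close>.\<close>
  also have "\<dots> \<le> (\<Sum>t<d. \<Sum>k<r. \<Sum>l<r. (s k * s l * (a t k l)\<^sup>2 + s k * s l * (b t k l)\<^sup>2) / 2)"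
  proof (intro sum_mono)
    fix t k l assume "k \<in> {..<r}" "l \<in> {..<r}"
    then have "0 \<le> s k * s l" using s by simp
    moreover have "a t k l * b t k l \<le> ((a t k l)\<^sup>2 + (b t k l)\<^sup>2) / 2"
      using sum_squares_bound[of "a t k l" "b t k l"] by simp
    ultimately have "s k * s l * (a t k l * b t k l) \<le> s k * s l * (((a t k l)\<^sup>2 + (b t k l)\<^sup>2) / 2)"
      by (intro mult_left_mono)
    then show "\<bar>s k * s l\<bar> * a t k l * b t k l \<le> (s k * s l * (a t k l)\<^sup>2 + s k * s l * (b t k l)\<^sup>2) / 2"
      using \<open>0 \<le> s k * s l\<close> by (simp add: algebra_simps)
  qed
  also have "\<dots> = ((\<Sum>t<d. \<Sum>k<r. \<Sum>l<r. s k * s l * (a t k l)\<^sup>2)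
      + (\<Sum>t<d. \<Sum>k<r. \<Sum>l<r. s k * s l * (b t k l)\<^sup>2)) / 2"
    by (simp only: sum.distrib sum_divide_distrib[symmetric])
  also have "\<dots> \<le> (K * (\<Sum>k<r. (s k)\<^sup>2) + K * (\<Sum>k<r. (s k)\<^sup>2)) / 2"
    unfolding a_def b_def
    using sum_compressions_le[OF A u, of s] sum_compressions_le[OF X w, of s] by simp
  also have "\<dots> = K * (\<Sum>i<m. \<Sum>j<n. (cmod (V i j))\<^sup>2)"
    by (simp add: norm)
  finally show ?thesis .
qed

text \<open>Conjugating \<open>V\<close> preserves its norm, so a bound on the real part of one form
  for all \<open>V\<close> carries over to the form with both families conjugated.\<close>

lemma tensor_form_cnj:
  "tensor_form d m n (\<lambda>t i j. cnj (A t i j)) (\<lambda>t i j. cnj (X t i j)) V =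
   cnj (tensor_form d m n A X (\<lambda>i j. cnj (V i j)))"
  by (simp add: tensor_form_def)

text \<open>Polarization at \<open>x\<close> and \<open>y = H x / K\<close>.\<close>

lemma hermitian_norm_le_numerical_radius:
  assumes herm: "\<And>i j. i < n \<Longrightarrow> j < n \<Longrightarrow> H j i = cnj (H i j)"
    and K: "0 < K" and rad: "\<And>x. cmod (cinner n (mat_app n H x) x) \<le> K * (\<Sum>i<n. (cmod (x i))\<^sup>2)"
  shows "(\<Sum>i<n. (cmod (mat_app n H x i))\<^sup>2) \<le> K\<^sup>2 * (\<Sum>i<n. (cmod (x i))\<^sup>2)"
proof -
  \<comment> \<open>With the factor \<open>1 / K\<close>, polarization and the parallelogram law
    give \<open>4 * h / K\<close> at most \<open>K * (2 * q + 2 * h / K^2)\<close>, which rearranges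
    to \<open>h\<close> at most \<open>K^2 * q\<close>.\<close>
  define y where "y = (\<lambda>i. of_real (1 / K) * mat_app n H x i)"
  define h where "h = (\<Sum>i<n. (cmod (mat_app n H x i))\<^sup>2)"
  define q where "q = (\<Sum>i<n. (cmod (x i))\<^sup>2)"
  define f where "f z = Re (cinner n (mat_app n H z) z)" for z
  have hxy: "cinner n (mat_app n H x) y = of_real (h / K)"
    unfolding y_def cinner_scale_right cinner_self h_def by simp
  have hyx: "cinner n (mat_app n H y) x = of_real (h / K)"
  proof -
    have "cinner n (mat_app n H y) x = cinner n y (mat_app n H x)"
      using herm by (rule cinner_mat_app_hermitian)
    also have "\<dots> = cnj (cinner n (mat_app n H x) y)" by (rule cinner_commute)
    finally show ?thesis by (simp add: hxy)
  qed
  have app: "mat_app n H (\<lambda>i. x i + y i) i = mat_app n H x i + mat_app n H y i"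
      "mat_app n H (\<lambda>i. x i - y i) i = mat_app n H x i - mat_app n H y i" for i
    by (simp_all add: mat_app_def sum.distrib sum_subtractf algebra_simps)
  have "f (\<lambda>i. x i + y i) - f (\<lambda>i. x i - y i) =
      2 * Re (cinner n (mat_app n H x) y) + 2 * Re (cinner n (mat_app n H y) x)"
    unfolding f_def cinner_def app
    by (simp add: algebra_simps sum.distrib sum_subtractf)
  also have "\<dots> = 4 * h / K" by (simp add: hxy hyx)
  finally have "4 * h / K \<le> \<bar>f (\<lambda>i. x i + y i)\<bar> + \<bar>f (\<lambda>i. x i - y i)\<bar>" by linarith
  also have "\<dots> \<le> K * (\<Sum>i<n. (cmod (x i + y i))\<^sup>2) + K * (\<Sum>i<n. (cmod (x i - y i))\<^sup>2)"
    unfolding f_def by (intro add_mono order_trans[OF abs_Re_le_cmod rad])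
  also have "\<dots> = K * (\<Sum>i<n. 2 * (cmod (x i))\<^sup>2 + 2 * (cmod (y i))\<^sup>2)"
    unfolding distrib_left[symmetric] sum.distrib[symmetric]
    by (intro arg_cong2[of _ _ _ _ "(*)"] refl sum.cong) (simp add: cmod_power2, simp add: power2_eq_square algebra_simps)
  also have "\<dots> = K * (2 * q + 2 * h / K\<^sup>2)"
    unfolding y_def q_def h_def using K
    by (simp add: sum.distrib norm_mult power_mult_distrib power_divide norm_divide flip: sum_distrib_left sum_divide_distrib)
  finally have "4 * h / K * K \<le> K * (2 * q + 2 * h / K\<^sup>2) * K"
    using K by (intro mult_right_mono) auto
  also have "\<dots> = 2 * K\<^sup>2 * q + 2 * h"
    using K by (simp add: field_simps power2_eq_square)
  finally show ?thesis using K by (simp add: h_def q_def)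
qed

section \<open>Operator norms and Kronecker products\<close>

lemma sum_grid:
  "(\<Sum>p<m * n. f (p div n) (p mod n)) = (\<Sum>i<m. \<Sum>j<n. f i j)" for m n :: nat
proof -
  have "(\<Sum>p<m * n. f (p div n) (p mod n)) = (\<Sum>i<m. \<Sum>p=i * n..<i * n + n. f (p div n) (p mod n))"
    by (rule sum.nat_group[symmetric])
  also have "\<dots> = (\<Sum>i<m. \<Sum>j<n. f i j)"
  proof (rule sum.cong[OF refl])
    fix i
    have "(\<Sum>p=i * n..<i * n + n. f (p div n) (p mod n)) = (\<Sum>j=0..<n. f ((j + i * n) div n) ((j + i * n) mod n))"
      using sum.shift_bounds_nat_ivl[of "\<lambda>p. f (p div n) (p mod n)" 0 "i * n" n] by (simp add: add.commute)
    also have "\<dots> = (\<Sum>j<n. f i j)"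
      unfolding atLeast0LessThan by (intro sum.cong refl) simp
    finally show "(\<Sum>p=i * n..<i * n + n. f (p div n) (p mod n)) = (\<Sum>j<n. f i j)" .
  qed
  finally show ?thesis .
qed

abbreviation entries :: "complex mat list \<Rightarrow> nat \<Rightarrow> nat \<Rightarrow> nat \<Rightarrow> complex" where
  "entries A \<equiv> \<lambda>t i j. (A ! t) $$ (i, j)"

lemma self_adjoint_mat_iff:
  assumes "M \<in> carrier_mat n n"
  shows "self_adjoint_mat M \<longleftrightarrow> (\<forall>i<n. \<forall>j<n. cnj (M $$ (j, i)) = M $$ (i, j))"
proof -
  have "mat_adjoint M = mat n n (\<lambda>(i, j). cnj (M $$ (j, i)))"
    using assms by (intro eq_matI) (auto simp: mat_adjoint_def mat_of_rows_index)
  then show ?thesis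
    using assms by (simp add: self_adjoint_mat_def mat_eq_iff)
qed

lemma cscalar_prod_eq_cinner:
  assumes "dim_vec y = n"
  shows "x \<bullet>c y = cinner n (($) x) (($) y)"
  using assms by (simp add: scalar_prod_def cinner_def atLeast0LessThan)

lemma mult_mat_vec_eq_mat_app:
  assumes "M \<in> carrier_mat m n" "v \<in> carrier_vec n" "i < m"
  shows "(M *\<^sub>v v) $ i = mat_app n (\<lambda>i j. M $$ (i, j)) (($) v) i"
  using assms by (simp add: scalar_prod_def mat_app_def atLeast0LessThan)

section \<open>Euclidean norm and operator norm\<close>

lemma vec_norm_square: "(vec_norm v)\<^sup>2 = (\<Sum>i<dim_vec v. (cmod (v $ i))\<^sup>2)"
  by (simp add: vec_norm_def L2_set_def sum_nonneg)

lemma vec_norm_nonneg: "0 \<le> vec_norm v"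
  by (simp add: vec_norm_def)

lemma vec_norm_smult: "vec_norm (a \<cdot>\<^sub>v v) = cmod a * vec_norm v"
  by (simp add: vec_norm_def norm_mult L2_set_right_distrib cong: L2_set_cong_simp)

lemma vec_norm_eq_0_iff: "vec_norm v = 0 \<longleftrightarrow> (\<forall>i<dim_vec v. v $ i = 0)"
  by (auto simp: vec_norm_def L2_set_eq_0_iff)

lemma vec_norm_conj: "vec_norm (map_vec cnj v) = vec_norm v"
  by (simp add: vec_norm_def cong: L2_set_cong_simp)

lemma cmod_cscalar_prod_le:
  assumes "dim_vec x = dim_vec y"
  shows "cmod (x \<bullet>c y) \<le> vec_norm x * vec_norm y"
proof -
  have "cmod (x \<bullet>c y) \<le> (\<Sum>i<dim_vec y. \<bar>cmod (x $ i)\<bar> * \<bar>cmod (y $ i)\<bar>)"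
    unfolding cscalar_prod_eq_cinner[OF refl] cinner_def
    by (rule sum_norm_le) (simp add: norm_mult)
  also have "\<dots> \<le> vec_norm x * vec_norm y"
    unfolding vec_norm_def assms by (rule L2_set_mult_ineq)
  finally show ?thesis .
qed

text \<open>A real supremum is informative only over a bounded set; the sum of the moduli of all
  entries is a crude bound.\<close>

lemma bdd_above_op_norm:
  "bdd_above ((\<lambda>v. vec_norm (M *\<^sub>v v)) ` {v \<in> carrier_vec (dim_col M). vec_norm v \<le> 1})"
proof (rule bdd_aboveI2)
  fix v assume v: "v \<in> {v \<in> carrier_vec (dim_col M). vec_norm v \<le> 1}"
  have comp: "cmod (v $ j) \<le> 1" if "j < dim_col M" for j
  proof -
    have "cmod (v $ j) \<le> vec_norm v"
      unfolding vec_norm_def using v that by (intro member_le_L2_set) auto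
    then show ?thesis using v by simp
  qed
  have "vec_norm (M *\<^sub>v v) \<le> (\<Sum>i<dim_row M. cmod ((M *\<^sub>v v) $ i))"
    unfolding vec_norm_def by (rule order_trans[OF L2_set_le_sum]) auto
  also have "\<dots> \<le> (\<Sum>i<dim_row M. \<Sum>j<dim_col M. cmod (M $$ (i, j)))"
  proof (rule sum_mono)
    fix i assume "i \<in> {..<dim_row M}"
    then have "(M *\<^sub>v v) $ i = (\<Sum>j<dim_col M. M $$ (i, j) * v $ j)"
      using v by (auto simp: scalar_prod_def atLeast0LessThan)
    also have "cmod \<dots> \<le> (\<Sum>j<dim_col M. cmod (M $$ (i, j)))"
      using comp by (intro sum_norm_le) (auto simp: norm_mult intro: mult_left_le)
    finally show "cmod ((M *\<^sub>v v) $ i) \<le> (\<Sum>j<dim_col M. cmod (M $$ (i, j)))" .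
  qed
  finally show "vec_norm (M *\<^sub>v v) \<le> (\<Sum>i<dim_row M. \<Sum>j<dim_col M. cmod (M $$ (i, j)))" .
qed

lemma vec_norm_mult_mat_vec_le:
  assumes v: "v \<in> carrier_vec (dim_col M)"
  shows "vec_norm (M *\<^sub>v v) \<le> op_norm M * vec_norm v"
proof (cases "vec_norm v = 0")
  case True
  then have "v = 0\<^sub>v (dim_col M)" using v by (intro eq_vecI) (auto simp: vec_norm_eq_0_iff)
  then have "M *\<^sub>v v = 0\<^sub>v (dim_row M)" by (intro eq_vecI) auto
  then have "vec_norm (M *\<^sub>v v) = 0" by (simp add: vec_norm_eq_0_iff)
  then show ?thesis using True by simp
next
  case False
  then have pos: "0 < vec_norm v" using vec_norm_nonneg[of v] by simp
  define x where "x = of_real (1 / vec_norm v) \<cdot>\<^sub>v v"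
  have "vec_norm x = 1" using pos by (simp add: x_def vec_norm_smult norm_divide)
  then have "vec_norm (M *\<^sub>v x) \<le> op_norm M"
    unfolding op_norm_def using v by (intro cSUP_upper bdd_above_op_norm) (auto simp: x_def)
  moreover have "M *\<^sub>v x = of_real (1 / vec_norm v) \<cdot>\<^sub>v (M *\<^sub>v v)"
    unfolding x_def using v by (intro mult_mat_vec[of M "dim_row M" "dim_col M"]) auto
  ultimately show ?thesis
    using pos by (simp add: vec_norm_smult norm_divide field_simps)
qed

lemma op_norm_leI:
  assumes "0 \<le> c" "\<And>v. v \<in> carrier_vec (dim_col M) \<Longrightarrow> vec_norm (M *\<^sub>v v) \<le> c * vec_norm v"
  shows "op_norm M \<le> c"
  unfolding op_norm_def
proof (rule cSUP_least)
  have "vec_norm (0\<^sub>v (dim_col M)) = 0" by (simp add: vec_norm_eq_0_iff)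
  then show "{v \<in> carrier_vec (dim_col M). vec_norm v \<le> 1} \<noteq> {}"
    using zero_carrier_vec[of "dim_col M"] by fastforce
next
  fix v assume "v \<in> {v \<in> carrier_vec (dim_col M). vec_norm v \<le> 1}"
  then show "vec_norm (M *\<^sub>v v) \<le> c"
    using assms mult_left_le[of "vec_norm v" c] by fastforce
qed

section \<open>Self-adjoint tuples and matrices on a tensor product\<close>

lemma cnj_sa_tuples_entry:
  assumes "X \<in> sa_tuples d n" "t < d" "i < n" "j < n"
  shows "cnj ((X ! t) $$ (j, i)) = (X ! t) $$ (i, j)"
  using assms self_adjoint_mat_iff[of "X ! t" n] unfolding sa_tuples_def by blast

text \<open>Vectors in \<open>\<complex>\<^sup>m \<otimes> \<complex>\<^sup>n\<close> are functions of a pair \<open>(i, j)\<close>, placed at position \<open>i n + j\<close> as in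
  \<open>kronecker\<close>.\<close>

definition grid_vec :: "nat \<Rightarrow> nat \<Rightarrow> (nat \<Rightarrow> nat \<Rightarrow> complex) \<Rightarrow> complex vec" where
  "grid_vec m n V = vec (m * n) (\<lambda>p. V (p div n) (p mod n))"

lemma grid_vec_carrier [simp]: "grid_vec m n V \<in> carrier_vec (m * n)"
  by (simp add: grid_vec_def)

lemma grid_vec_surj:
  assumes "v \<in> carrier_vec (m * n)"
  obtains V where "v = grid_vec m n V"
proof
  show "v = grid_vec m n (\<lambda>i j. v $ (i * n + j))"
    using assms by (intro eq_vecI) (auto simp: grid_vec_def)
qed

lemma vec_norm_grid_vec: "(vec_norm (grid_vec m n V))\<^sup>2 = (\<Sum>i<m. \<Sum>j<n. (cmod (V i j))\<^sup>2)"
proof -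
  have "(vec_norm (grid_vec m n V))\<^sup>2 = (\<Sum>p<m * n. (cmod (V (p div n) (p mod n)))\<^sup>2)"
    by (simp add: vec_norm_square grid_vec_def)
  then show ?thesis using sum_grid[of "\<lambda>i j. (cmod (V i j))\<^sup>2"] by simp
qed

text \<open>The matrix common to \<open>frakD\<close> and \<open>polar_dual_level\<close>. Its
  arguments are functions rather than lists, so that conjugated tuples fit directly.\<close>

definition tensor_mat :: "nat \<Rightarrow> nat \<Rightarrow> nat \<Rightarrow> (nat \<Rightarrow> complex mat) \<Rightarrow> (nat \<Rightarrow> complex mat) \<Rightarrow> complex mat" where
  "tensor_mat d m n A X = sum_mats (m * n) d (\<lambda>t. kronecker (A t) (X t))"

lemma tensor_mat_carrier [simp]: "tensor_mat d m n A X \<in> carrier_mat (m * n) (m * n)"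
  by (simp add: tensor_mat_def sum_mats_def)

lemma div_mod_less_grid:
  fixes p m n :: nat
  assumes "p < m * n"
  shows "p div n < m" "p mod n < n"
  using assms by (cases "n = 0"; simp add: less_mult_imp_div_less)+

lemma tensor_mat_index:
  assumes "\<And>t. t < d \<Longrightarrow> A t \<in> carrier_mat m m" "\<And>t. t < d \<Longrightarrow> X t \<in> carrier_mat n n"
    and "p < m * n" "q < m * n"
  shows "tensor_mat d m n A X $$ (p, q) =
    (\<Sum>t<d. A t $$ (p div n, q div n) * X t $$ (p mod n, q mod n))"
proof -
  have "tensor_mat d m n A X $$ (p, q) = (\<Sum>t<d. kronecker (A t) (X t) $$ (p, q))"
    using assms by (simp add: tensor_mat_def sum_mats_def)
  also have "\<dots> = (\<Sum>t<d. A t $$ (p div n, q div n) * X t $$ (p mod n, q mod n))"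
  proof (intro sum.cong refl)
    fix t assume "t \<in> {..<d}"
    then have "A t \<in> carrier_mat m m" "X t \<in> carrier_mat n n" using assms by auto
    then show "kronecker (A t) (X t) $$ (p, q) = A t $$ (p div n, q div n) * X t $$ (p mod n, q mod n)"
      using assms(3,4) by (simp add: kronecker_def)
  qed
  finally show ?thesis .
qed

lemma tensor_mat_quadratic_form:
  assumes A: "\<And>t. t < d \<Longrightarrow> A t \<in> carrier_mat m m" and X: "\<And>t. t < d \<Longrightarrow> X t \<in> carrier_mat n n"
  shows "(tensor_mat d m n A X *\<^sub>v grid_vec m n V) \<bullet>c grid_vec m n V =
    tensor_form d m n (\<lambda>t i j. A t $$ (i, j)) (\<lambda>t i j. X t $$ (i, j)) V"
proof -
  let ?M = "tensor_mat d m n A X" and ?v = "grid_vec m n V"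
  have row: "(?M *\<^sub>v ?v) $ p = (\<Sum>i'<m. \<Sum>j'<n.
      (\<Sum>t<d. A t $$ (p div n, i') * X t $$ (p mod n, j')) * V i' j')" if p: "p < m * n" for p
  proof -
    have "(?M *\<^sub>v ?v) $ p = (\<Sum>q<m * n. ?M $$ (p, q) * ?v $ q)"
      using p by (subst mult_mat_vec_eq_mat_app[OF tensor_mat_carrier]) (auto simp: mat_app_def)
    also have "\<dots> = (\<Sum>q<m * n. (\<Sum>t<d. A t $$ (p div n, q div n) * X t $$ (p mod n, q mod n)) *
        V (q div n) (q mod n))"
      using p by (intro sum.cong refl) (simp add: tensor_mat_index[OF A X] grid_vec_def)
    also have "\<dots> = (\<Sum>i'<m. \<Sum>j'<n. (\<Sum>t<d. A t $$ (p div n, i') * X t $$ (p mod n, j')) * V i' j')"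
      by (rule sum_grid)
    finally show ?thesis .
  qed
  have "(?M *\<^sub>v ?v) \<bullet>c ?v = (\<Sum>p<m * n. (?M *\<^sub>v ?v) $ p * cnj (?v $ p))"
    by (subst cscalar_prod_eq_cinner[of _ "m * n"]) (auto simp: cinner_def grid_vec_def)
  also have "\<dots> = (\<Sum>p<m * n. (\<Sum>i'<m. \<Sum>j'<n. (\<Sum>t<d. A t $$ (p div n, i') * X t $$ (p mod n, j')) * V i' j') *
      cnj (V (p div n) (p mod n)))"
    by (intro sum.cong refl) (simp add: row, simp add: grid_vec_def)
  also have "\<dots> = tensor_form d m n (\<lambda>t i j. A t $$ (i, j)) (\<lambda>t i j. X t $$ (i, j)) V"
    unfolding tensor_form_def by (rule sum_grid)
  finally show ?thesis .
qed

section \<open>Self-duality\<close>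

lemma conj_mat_index:
  assumes "M \<in> carrier_mat m n" "i < m" "j < n"
  shows "conj_mat M $$ (i, j) = cnj (M $$ (i, j))"
  using assms by simp

section \<open>Hermitian matrices: Loewner order and numerical radius\<close>

lemma tensor_mat_hermitian:
  assumes A: "A \<in> sa_tuples d m" and X: "X \<in> sa_tuples d n" and pq: "p < m * n" "q < m * n"
  shows "cnj (tensor_mat d m n ((!) A) ((!) X) $$ (q, p)) = tensor_mat d m n ((!) A) ((!) X) $$ (p, q)"
proof -
  have c: "A ! t \<in> carrier_mat m m" "X ! t \<in> carrier_mat n n" if "t < d" for t
    using A X that by (auto simp: sa_tuples_def)
  show ?thesis
    using pq div_mod_less_grid[OF pq(1)] div_mod_less_grid[OF pq(2)]
    by (simp add: tensor_mat_index[OF c] cnj_sa_tuples_entry[OF A] cnj_sa_tuples_entry[OF X])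
qed

text \<open>The order on complex numbers compares only numbers with equal imaginary parts; this
  reduces positivity of a form to its real part.\<close>

lemma Im_quadratic_form:
  assumes M: "M \<in> carrier_mat N N" and v: "v \<in> carrier_vec N"
    and herm: "\<And>i j. i < N \<Longrightarrow> j < N \<Longrightarrow> cnj (M $$ (j, i)) = M $$ (i, j)"
  shows "Im ((M *\<^sub>v v) \<bullet>c v) = 0"
proof -
  let ?H = "\<lambda>i j. M $$ (i, j)"
  have "(M *\<^sub>v v) \<bullet>c v = cinner N (($) (M *\<^sub>v v)) (($) v)"
    using v by (intro cscalar_prod_eq_cinner) simp
  also have "\<dots> = cinner N (mat_app N ?H (($) v)) (($) v)"
    using mult_mat_vec_eq_mat_app[OF M v] by (intro cinner_cong) auto
  finally have eq: "(M *\<^sub>v v) \<bullet>c v = cinner N (mat_app N ?H (($) v)) (($) v)" .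
  also have "\<dots> = cinner N (($) v) (mat_app N ?H (($) v))"
    by (rule cinner_mat_app_hermitian) (rule herm[symmetric])
  also have "\<dots> = cnj ((M *\<^sub>v v) \<bullet>c v)"
    unfolding eq by (rule cinner_commute)
  finally have "Im ((M *\<^sub>v v) \<bullet>c v) = Im (cnj ((M *\<^sub>v v) \<bullet>c v))" by (rule arg_cong)
  then show ?thesis by simp
qed

lemma loewner_le_one_iff:
  assumes M: "M \<in> carrier_mat N N"
    and herm: "\<And>i j. i < N \<Longrightarrow> j < N \<Longrightarrow> cnj (M $$ (j, i)) = M $$ (i, j)"
  shows "loewner_le M (1\<^sub>m N) \<longleftrightarrow> (\<forall>v \<in> carrier_vec N. Re ((M *\<^sub>v v) \<bullet>c v) \<le> (vec_norm v)\<^sup>2)"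
proof -
  have "1\<^sub>m N - M \<in> carrier_mat N N" using M by (intro minus_carrier_mat)
  then have "self_adjoint_mat (1\<^sub>m N - M)"
    using M herm by (subst self_adjoint_mat_iff) auto
  moreover have "0 \<le> ((1\<^sub>m N - M) *\<^sub>v v) \<bullet>c v \<longleftrightarrow> Re ((M *\<^sub>v v) \<bullet>c v) \<le> (vec_norm v)\<^sup>2"
    if v: "v \<in> carrier_vec N" for v
  proof -
    have "((1\<^sub>m N - M) *\<^sub>v v) \<bullet>c v = v \<bullet>c v - (M *\<^sub>v v) \<bullet>c v"
      using M v by (simp add: minus_mult_distrib_mat_vec[of _ N N] minus_scalar_prod_distrib[of _ N])
    also have "v \<bullet>c v = of_real ((vec_norm v)\<^sup>2)"
      by (simp only: cscalar_prod_eq_cinner[OF refl] cinner_self vec_norm_square)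
    finally have "((1\<^sub>m N - M) *\<^sub>v v) \<bullet>c v = of_real ((vec_norm v)\<^sup>2) - (M *\<^sub>v v) \<bullet>c v" .
    then show ?thesis
      using Im_quadratic_form[OF M v herm] by (simp add: less_eq_complex_def)
  qed
  ultimately show ?thesis
    using M by (simp add: loewner_le_def pos_semidef_mat_def)
qed

lemma vec_norm_le_numerical_radius:
  assumes M: "M \<in> carrier_mat N N"
    and herm: "\<And>i j. i < N \<Longrightarrow> j < N \<Longrightarrow> cnj (M $$ (j, i)) = M $$ (i, j)"
    and K: "0 < K" and rad: "\<And>v. v \<in> carrier_vec N \<Longrightarrow> cmod ((M *\<^sub>v v) \<bullet>c v) \<le> K * (vec_norm v)\<^sup>2"
    and v: "v \<in> carrier_vec N"
  shows "vec_norm (M *\<^sub>v v) \<le> K * vec_norm v"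
proof -
  let ?H = "\<lambda>i j. M $$ (i, j)"
  have radius: "cmod (cinner N (mat_app N ?H x) x) \<le> K * (\<Sum>i<N. (cmod (x i))\<^sup>2)" for x
  proof -
    have "cinner N (mat_app N ?H x) x = (M *\<^sub>v vec N x) \<bullet>c vec N x"
      using M by (subst cscalar_prod_eq_cinner[of _ N], simp, intro cinner_cong)
        (auto simp: mat_app_def scalar_prod_def atLeast0LessThan)
    then show ?thesis using rad[of "vec N x"] by (simp add: vec_norm_square)
  qed
  have "(\<Sum>i<N. (cmod (mat_app N ?H (($) v) i))\<^sup>2) \<le> K\<^sup>2 * (\<Sum>i<N. (cmod (v $ i))\<^sup>2)"
    using K radius
    by (intro hermitian_norm_le_numerical_radius[where H = ?H and n = N and x = "($) v" and K = K])
      (auto simp: herm)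
  moreover have "(vec_norm (M *\<^sub>v v))\<^sup>2 = (\<Sum>i<N. (cmod (mat_app N ?H (($) v) i))\<^sup>2)"
    unfolding vec_norm_square using M mult_mat_vec_eq_mat_app[OF M v]
    by (intro sum.cong) (simp_all del: index_mult_mat_vec)
  ultimately have "(vec_norm (M *\<^sub>v v))\<^sup>2 \<le> (K * vec_norm v)\<^sup>2"
    using v by (simp add: vec_norm_square power_mult_distrib)
  then show ?thesis
    by (rule power2_le_imp_le) (use K vec_norm_nonneg[of v] in simp)
qed

section \<open>The two inclusions\<close>

lemma frakD_tensor_form_le:
  assumes "A \<in> frakD d" "A \<in> sa_tuples d m"
  shows "Re (tensor_form d m m (entries A) (\<lambda>t i j. cnj (entries A t i j)) P)
    \<le> 1 * (\<Sum>i<m. \<Sum>j<m. (cmod (P i j))\<^sup>2)"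
\<comment> \<open>For \<open>d = 0\<close> the empty list belongs to every level, so
  \<open>m\<close> need not be the level at which the norm bound is given; the form is then
  zero.\<close>
proof (cases "d = 0")
  case True
  then show ?thesis by (simp add: tensor_form_def sum_nonneg)
next
  case False
  have c: "A ! t \<in> carrier_mat m m" if "t < d" for t
    using assms(2) that by (auto simp: sa_tuples_def)
  obtain m' where "A \<in> sa_tuples d m'"
    and op: "op_norm (tensor_mat d m' m' ((!) A) (\<lambda>t. conj_mat (A ! t))) \<le> 1"
    using assms(1) by (auto simp: frakD_def tensor_mat_def)
  \<comment> \<open>The size of the first entry identifies the level \<open>m'\<close> of the norm
    bound with \<open>m\<close>.\<close>
  then have "A ! 0 \<in> carrier_mat m' m'" using False by (auto simp: sa_tuples_def)
  then have "m' = m" using c[of 0] False by auto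
  define M where "M = tensor_mat d m m ((!) A) (\<lambda>t. conj_mat (A ! t))"
  let ?v = "grid_vec m m P"
  have M: "M \<in> carrier_mat (m * m) (m * m)" by (simp add: M_def)
  have "(M *\<^sub>v ?v) \<bullet>c ?v = tensor_form d m m (entries A) (\<lambda>t i j. conj_mat (A ! t) $$ (i, j)) P"
    unfolding M_def using c by (intro tensor_mat_quadratic_form) auto
  also have "\<dots> = tensor_form d m m (entries A) (\<lambda>t i j. cnj (entries A t i j)) P"
    by (intro tensor_form_cong) (simp_all add: conj_mat_index[OF c])
  finally have "Re (tensor_form d m m (entries A) (\<lambda>t i j. cnj (entries A t i j)) P)
      \<le> cmod ((M *\<^sub>v ?v) \<bullet>c ?v)"
    by (simp add: complex_Re_le_cmod)
  also have "\<dots> \<le> vec_norm (M *\<^sub>v ?v) * vec_norm ?v"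
    using M by (intro cmod_cscalar_prod_le) (simp add: grid_vec_def)
  also have "\<dots> \<le> (1 * vec_norm ?v) * vec_norm ?v"
  proof (rule mult_right_mono)
    have "vec_norm (M *\<^sub>v ?v) \<le> op_norm M * vec_norm ?v"
      using M by (intro vec_norm_mult_mat_vec_le) simp
    also have "\<dots> \<le> 1 * vec_norm ?v"
      using op \<open>m' = m\<close> by (intro mult_right_mono vec_norm_nonneg) (simp add: M_def)
    finally show "vec_norm (M *\<^sub>v ?v) \<le> 1 * vec_norm ?v" .
  qed (rule vec_norm_nonneg)
  also have "\<dots> = 1 * (\<Sum>i<m. \<Sum>j<m. (cmod (P i j))\<^sup>2)"
    unfolding vec_norm_grid_vec[symmetric] by (simp add: power2_eq_square)
  finally show ?thesis .
qed

lemma frakD_subset_polar_dual: "frakD d \<subseteq> polar_dual d (frakD d)"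
proof
  fix X assume X: "X \<in> frakD d"
  then obtain n where n: "1 \<le> n" and Xn: "X \<in> sa_tuples d n" by (auto simp: frakD_def)
  have "loewner_le (tensor_mat d m n ((!) A) ((!) X)) (1\<^sub>m (m * n))"
    if A: "A \<in> frakD d" and Am: "A \<in> sa_tuples d m" for m A
  proof (subst loewner_le_one_iff)
    show "\<forall>v\<in>carrier_vec (m * n). Re ((tensor_mat d m n ((!) A) ((!) X) *\<^sub>v v) \<bullet>c v) \<le> (vec_norm v)\<^sup>2"
    proof
      fix v :: "complex vec" assume "v \<in> carrier_vec (m * n)"
      then obtain V where v: "v = grid_vec m n V" by (rule grid_vec_surj)
      have "Re ((tensor_mat d m n ((!) A) ((!) X) *\<^sub>v v) \<bullet>c v) \<le> cmod (tensor_form d m n (entries A) (entries X) V)"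
        using Am Xn unfolding v
        by (subst tensor_mat_quadratic_form) (auto simp: sa_tuples_def complex_Re_le_cmod)
      also have "\<dots> \<le> 1 * (\<Sum>i<m. \<Sum>j<n. (cmod (V i j))\<^sup>2)"
        using frakD_tensor_form_le[OF A Am] frakD_tensor_form_le[OF X Xn]
        by (rule tensor_form_cauchy_schwarz)
      finally show "Re ((tensor_mat d m n ((!) A) ((!) X) *\<^sub>v v) \<bullet>c v) \<le> (vec_norm v)\<^sup>2"
        by (simp add: v vec_norm_grid_vec)
    qed
  qed (use tensor_mat_hermitian[OF Am Xn] in auto)
  then show "X \<in> polar_dual d (frakD d)"
    using n Xn by (auto simp: polar_dual_def polar_dual_level_def tensor_mat_def)
qed

lemma polar_dual_subset_frakD: "polar_dual d (frakD d) \<subseteq> frakD d"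
proof
  fix X assume "X \<in> polar_dual d (frakD d)"
  then obtain n where n: "1 \<le> n" and X: "X \<in> sa_tuples d n"
    and polar: "\<And>m A. 1 \<le> m \<Longrightarrow> A \<in> frakD d \<Longrightarrow> A \<in> sa_tuples d m \<Longrightarrow>
      loewner_le (tensor_mat d m n ((!) A) ((!) X)) (1\<^sub>m (m * n))"
    by (auto simp: polar_dual_def polar_dual_level_def tensor_mat_def)
  have cX: "X ! t \<in> carrier_mat n n" if "t < d" for t
    using X that by (auto simp: sa_tuples_def)
  define T where "T = tensor_mat d n n ((!) X) (\<lambda>t. conj_mat (X ! t))"
  have T: "T \<in> carrier_mat (n * n) (n * n)" by (simp add: T_def)
  have T_index: "T $$ (p, q) = (\<Sum>t<d. (X ! t) $$ (p div n, q div n) * cnj ((X ! t) $$ (p mod n, q mod n)))"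
    if "p < n * n" "q < n * n" for p q
  proof -
    have "T $$ (p, q) = (\<Sum>t<d. (X ! t) $$ (p div n, q div n) * conj_mat (X ! t) $$ (p mod n, q mod n))"
      unfolding T_def using that cX by (intro tensor_mat_index) auto
    also have "\<dots> = (\<Sum>t<d. (X ! t) $$ (p div n, q div n) * cnj ((X ! t) $$ (p mod n, q mod n)))"
      using div_mod_less_grid[OF that(1)] div_mod_less_grid[OF that(2)]
      by (intro sum.cong refl) (simp add: conj_mat_index[OF cX])
    finally show ?thesis .
  qed
  have T_herm: "cnj (T $$ (q, p)) = T $$ (p, q)" if "p < n * n" "q < n * n" for p q
    using that div_mod_less_grid[OF that(1)] div_mod_less_grid[OF that(2)]
    by (simp add: T_index cnj_sa_tuples_entry[OF X])
  have "op_norm T \<le> 1"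
  proof (rule ccontr)
    define c where "c = op_norm T"
    assume "\<not> op_norm T \<le> 1"
    then have c: "1 < c" by (simp add: c_def)
    \<comment> \<open>Scaling a tuple by \<open>a\<close> scales its tensor with its own conjugate
      by \<open>a * a = 1 / c\<close>, which brings the norm \<open>c\<close> down to 1.\<close>
    define a where "a = 1 / sqrt c"
    have aa: "a * a = 1 / c" and a: "0 < a" using c by (auto simp: a_def)
    define A where "A = map (\<lambda>B. of_real a \<cdot>\<^sub>m conj_mat B) X"
    have len: "length X = d" using X by (simp add: sa_tuples_def)
    have A_nth: "A ! t = of_real a \<cdot>\<^sub>m conj_mat (X ! t)" if "t < d" for t
      using that len by (simp add: A_def)
    have cA: "A ! t \<in> carrier_mat n n" if "t < d" for t
      using cX[OF that] that by (auto simp: A_nth)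
    have A_index: "(A ! t) $$ (i, j) = of_real a * cnj ((X ! t) $$ (i, j))" if "t < d" "i < n" "j < n" for t i j
      using that cX[of t] by (auto simp: A_nth)
    have A: "A \<in> sa_tuples d n"
    proof -
      have "self_adjoint_mat (A ! t)" if "t < d" for t
        unfolding self_adjoint_mat_iff[OF cA[OF that]]
      proof (intro allI impI)
        fix i j assume "i < n" "j < n"
        then show "cnj ((A ! t) $$ (j, i)) = (A ! t) $$ (i, j)"
          using that cnj_sa_tuples_entry[OF X that, of j i] by (simp add: A_index)
      qed
      then show ?thesis using cA len by (auto simp: sa_tuples_def A_def)
    qed
    define S where "S = tensor_mat d n n ((!) A) (\<lambda>t. conj_mat (A ! t))"
    have S: "S \<in> carrier_mat (n * n) (n * n)" by (simp add: S_def)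
    have S_index: "S $$ (p, q) = of_real (1 / c) * cnj (T $$ (p, q))" if pq: "p < n * n" "q < n * n" for p q
    proof -
      note less = div_mod_less_grid[OF pq(1)] div_mod_less_grid[OF pq(2)]
      have "S $$ (p, q) = (\<Sum>t<d. (A ! t) $$ (p div n, q div n) * conj_mat (A ! t) $$ (p mod n, q mod n))"
        unfolding S_def using pq cA by (intro tensor_mat_index) auto
      also have "\<dots> = (\<Sum>t<d. of_real (a * a) * cnj ((X ! t) $$ (p div n, q div n) * cnj ((X ! t) $$ (p mod n, q mod n))))"
      proof (intro sum.cong refl)
        fix t assume "t \<in> {..<d}"
        then show "(A ! t) $$ (p div n, q div n) * conj_mat (A ! t) $$ (p mod n, q mod n) =
            of_real (a * a) * cnj ((X ! t) $$ (p div n, q div n) * cnj ((X ! t) $$ (p mod n, q mod n)))"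
          using less cA[of t] by (auto simp: A_index)
      qed
      also have "\<dots> = of_real (a * a) * cnj (T $$ (p, q))"
        by (simp only: T_index[OF pq] cnj_sum sum_distrib_left)
      finally show ?thesis by (simp only: aa)
    qed
    have "op_norm S \<le> 1"
    proof (rule op_norm_leI)
      fix v :: "complex vec" assume "v \<in> carrier_vec (dim_col S)"
      then have v: "v \<in> carrier_vec (n * n)" using S by simp
      \<comment> \<open>\<open>S\<close> is the conjugate of \<open>T\<close> divided by
        \<open>c\<close>, so it acts like \<open>T\<close> between two conjugations, and these
        preserve norms.\<close>
      have "S *\<^sub>v v = of_real (1 / c) \<cdot>\<^sub>v map_vec cnj (T *\<^sub>v map_vec cnj v)"
      proof (rule eq_vecI)
        fix p assume "p < dim_vec (of_real (1 / c) \<cdot>\<^sub>v map_vec cnj (T *\<^sub>v map_vec cnj v))"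
        then have p: "p < n * n" using T by simp
        have "(S *\<^sub>v v) $ p = (\<Sum>q<n * n. of_real (1 / c) * cnj (T $$ (p, q)) * v $ q)"
          unfolding mult_mat_vec_eq_mat_app[OF S v p] mat_app_def
          using p by (intro sum.cong refl) (simp only: S_index lessThan_iff)
        also have "\<dots> = of_real (1 / c) * cnj (\<Sum>q<n * n. T $$ (p, q) * map_vec cnj v $ q)"
          unfolding cnj_sum sum_distrib_left using v by (intro sum.cong refl) (auto simp: mult.assoc)
        also have "(\<Sum>q<n * n. T $$ (p, q) * map_vec cnj v $ q) = (T *\<^sub>v map_vec cnj v) $ p"
          using v p by (subst mult_mat_vec_eq_mat_app[OF T]) (auto simp: mat_app_def)
        finally show "(S *\<^sub>v v) $ p = (of_real (1 / c) \<cdot>\<^sub>v map_vec cnj (T *\<^sub>v map_vec cnj v)) $ p"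
          using p T by simp
      qed (use S T in simp)
      then have "vec_norm (S *\<^sub>v v) = 1 / c * vec_norm (T *\<^sub>v map_vec cnj v)"
        using c by (simp add: vec_norm_smult vec_norm_conj norm_divide)
      also have "\<dots> \<le> 1 / c * (c * vec_norm (map_vec cnj v))"
        using c T v unfolding c_def by (intro mult_left_mono vec_norm_mult_mat_vec_le) auto
      finally show "vec_norm (S *\<^sub>v v) \<le> 1 * vec_norm v"
        using c by (simp add: vec_norm_conj)
    qed simp
    then have "A \<in> frakD d"
      using A n by (auto simp: frakD_def S_def tensor_mat_def)
    then have le: "loewner_le (tensor_mat d n n ((!) A) ((!) X)) (1\<^sub>m (n * n))"
      using polar n A by blast
    let ?X = "entries X" and ?Y = "\<lambda>t i j. cnj (entries X t i j)"
    \<comment> \<open>Testing \<open>X\<close> against \<open>A\<close> bounds \<open>a\<close>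
      times this form by the squared norm; dividing by \<open>a\<close> produces
      \<open>sqrt c\<close>.\<close>
    have form_YX: "Re (tensor_form d n n ?Y ?X V) \<le> sqrt c * (\<Sum>i<n. \<Sum>j<n. (cmod (V i j))\<^sup>2)" for V
    proof -
      let ?v = "grid_vec n n V"
      have "of_real a * tensor_form d n n ?Y ?X V = tensor_form d n n (entries A) ?X V"
        unfolding tensor_form_scale_left[symmetric] by (intro tensor_form_cong) (simp_all add: A_index)
      also have "\<dots> = (tensor_mat d n n ((!) A) ((!) X) *\<^sub>v ?v) \<bullet>c ?v"
        using cA cX by (simp add: tensor_mat_quadratic_form)
      finally have "Re (of_real a * tensor_form d n n ?Y ?X V) =
          Re ((tensor_mat d n n ((!) A) ((!) X) *\<^sub>v ?v) \<bullet>c ?v)"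
        by (rule arg_cong)
      then have "a * Re (tensor_form d n n ?Y ?X V) = Re ((tensor_mat d n n ((!) A) ((!) X) *\<^sub>v ?v) \<bullet>c ?v)"
        by simp
      also have "\<dots> \<le> (vec_norm ?v)\<^sup>2"
        using le by (simp only: loewner_le_one_iff[OF tensor_mat_carrier tensor_mat_hermitian[OF A X]] grid_vec_carrier Ball_def)
      finally have "Re (tensor_form d n n ?Y ?X V) \<le> sqrt c * (vec_norm ?v)\<^sup>2"
        using c by (simp add: a_def field_simps)
      then show ?thesis by (simp add: vec_norm_grid_vec)
    qed
    have form_XY: "Re (tensor_form d n n ?X ?Y V) \<le> sqrt c * (\<Sum>i<n. \<Sum>j<n. (cmod (V i j))\<^sup>2)" for V
    proof -
      have "tensor_form d n n ?X ?Y V = cnj (tensor_form d n n ?Y ?X (\<lambda>i j. cnj (V i j)))"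
        using tensor_form_cnj[where A = ?Y and X = ?X] by simp
      then show ?thesis using form_YX[of "\<lambda>i j. cnj (V i j)"] by simp
    qed
    \<comment> \<open>The estimate is applied to the tuple and its conjugate; its second hypothesis
      involves the double conjugate, so it is exactly \<open>form_YX\<close>.\<close>
    have radius: "cmod (tensor_form d n n ?X ?Y V) \<le> sqrt c * (\<Sum>i<n. \<Sum>j<n. (cmod (V i j))\<^sup>2)" for V
      using form_XY form_YX by (intro tensor_form_cauchy_schwarz) simp_all
    have "op_norm T \<le> sqrt c"
    proof (rule op_norm_leI)
      fix v :: "complex vec" assume "v \<in> carrier_vec (dim_col T)"
      then have v: "v \<in> carrier_vec (n * n)" using T by simp
      show "vec_norm (T *\<^sub>v v) \<le> sqrt c * vec_norm v"
      proof (rule vec_norm_le_numerical_radius[OF T T_herm _ _ v])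
        fix w :: "complex vec" assume "w \<in> carrier_vec (n * n)"
        then obtain V where w: "w = grid_vec n n V" by (rule grid_vec_surj)
        have "(T *\<^sub>v w) \<bullet>c w = tensor_form d n n ?X (\<lambda>t i j. conj_mat (X ! t) $$ (i, j)) V"
          unfolding T_def w using cX by (intro tensor_mat_quadratic_form) auto
        also have "\<dots> = tensor_form d n n ?X ?Y V"
          by (intro tensor_form_cong) (simp_all add: conj_mat_index[OF cX])
        finally show "cmod ((T *\<^sub>v w) \<bullet>c w) \<le> sqrt c * (vec_norm w)\<^sup>2"
          using radius[of V] by (simp add: w vec_norm_grid_vec)
      qed (use c in simp_all)
    qed (use c in simp)
    then have "c \<le> sqrt c" by (simp add: c_def)
    \<comment> \<open>Cancelling the positive factor \<open>sqrt c\<close> leaves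
      \<open>sqrt c\<close> at most 1, against \<open>1 < c\<close>.\<close>
    then have "sqrt c * sqrt c \<le> sqrt c * 1" using c by simp
    then show False using c by (simp only: mult_le_cancel_left_pos real_sqrt_gt_0_iff) simp
  qed
  then show "X \<in> frakD d"
    using n X by (auto simp: frakD_def T_def tensor_mat_def)
qed

theorem lemma9p2:
  fixes d :: nat
  shows "polar_dual d (frakD d) = frakD d"
  using polar_dual_subset_frakD frakD_subset_polar_dual by (rule equalityI)

end
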